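(* Let $\Pi^\perp_\tau$ be the projection representation of a comtrace $\tau$ over a comtrace alphabet $\Theta$, and let $M(\Pi^\perp_\tau)$ be its set of possible actions. For every allowed set $B\in\mathbb{S}$ (constructed from $M(\Pi^\perp_\tau)$ as described below), we have \[\tau=[B]\circ\sigma,\quad\text{where }\sigma\text{ is the comtrace with }\Pi^\perp_\sigma=extr(\Pi^\perp_\tau,B).\]
   Context: A comtrace alphabet is $\Theta=(\Sigma,\mathit{sim},\mathit{ser})$ with $\mathit{ser}\subseteq\mathit{sim}\subseteq\Sigma\times\Sigma$, $\mathit{sim}$ irreflexive and symmetric. Steps $\mathbb{S}$ are nonempty sets of pairwise $\mathit{sim}$-related actions; comtrace equivalence $\equiv_\Theta$ is the reflexive, symmetric, transitive closure of $uABz\sim u(A\cup B)z$ for $A\times B\subseteq\mathit{ser}$; comtraces are its classes, concatenated by $[w]\circ[v]=[wv]$. Derived relations: $\mathit{dep}=(\Sigma\times\Sigma)\setminus\mathit{sim}$, $\mathit{ind}=\mathit{ser}\cap\mathit{ser}^{-1}$, $\mathit{sin}=\mathit{sim}\setminus\mathit{ser}$, $\mathit{ssm}=\mathit{sim}\setminus(\mathit{ser}\cup\mathit{ser}^{-1})$, $\mathit{wdp}=\mathit{ser}^{-1}\setminus\mathit{ser}$. For $(a,b)\notin\mathit{ind}$, the projection $\Pi^\perp_{a,b}$ maps a step $A$ to: $\epsilon$ if $\{a,b\}\cap A=\emptyset$; the single action of $\{a,b\}$ in $A$ if exactly one is in $A$; $ba$ if $\{a,b\}\subseteq A$, $(a,b)\in\mathit{wdp}$;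 $ab$ if $\{a,b\}\subseteq A$, $(b,a)\in\mathit{wdp}$; $\perp$ if $\{a,b\}\subseteq A$, $(a,b)\in\mathit{ssm}$; extended to step sequences by concatenation. The projection representation of $\tau$ is $\Pi^\perp_\tau(a,b)=\Pi^\perp_{a,b}(\tau)$ on $(\Sigma\times\Sigma)\setminus\mathit{ind}$; two step sequences are equivalent iff their projection representations agree. For a word $x$, write $x[1]$ for its first letter, $x[1..2]$ for its first two letters, and $x[k..]$ for the suffix of $x$ starting at its $k$-th letter (i.e. $x$ with its first $k-1$ letters removed). An action $a$ is conditionally possible for $\Pi^\perp$ iff for all $b$: $(a,b)\in\mathit{dep}\Rightarrow\Pi^\perp(a,b)[1]=a$; $(b,a)\in\mathit{wdp}\Rightarrow\Pi^\perp(a,b)[1]=a$; $(a,b)\in\mathit{wdp}\Rightarrow\Pi^\perp(a,b)[1]=a$ or $\Pi^\perp(a,b)[1..2]=ba$; $(a,b)\in\mathit{ssm}\Rightarrow\Pi^\perp(a,b)[1]\in\{a,\perp\}$. With $cpa$ the conditionally possible actions, $(a,b)\in cnd$ iff ($(a,b)\in\mathit{wdp}$ and $\Pi^\perp(a,b)[1..2]=ba$) or ($(a,b)\in\mathit{ssm}$ and $\Pi^\perp(a,b)[1]=\perp$); $imp$ is the smallest set containing $\Sigma\setminus cpa$ and closed under ($b\in imp,(a,b)\in cnd\Rightarrow a\in imp$); $M(\Pi^\perp)=\Sigma\setminus imp$. A step $A$ is indivisible if all its elements are related by the largest equivalence contained in the reflexive-transitive closure of $\mathit{sin}$ restricted to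 $A$. Splitting $M(\Pi^\perp)$ into its indivisible steps gives a step sequence of indivisible steps (the lexicographically least step sequence equivalent to the single step $M(\Pi^\perp)$), viewed as a Mazurkiewicz trace over the alphabet of indivisible steps where two indivisible steps $C,D$ are independent iff $C\times D\subseteq\mathit{ind}$. An allowed set $B$ is the union of the indivisible steps of any nonempty trace prefix of this trace. The extraction $extr(\Pi^\perp,B)(a,b)$ equals: $\Pi^\perp(a,b)$ if $|\{a,b\}\cap B|=0$; $\Pi^\perp(a,b)[2..]$ if $|\{a,b\}\cap B|=1$; $\Pi^\perp(a,b)[2..]$ if $|\{a,b\}\cap B|=2$ and $(a,b)\in\mathit{ssm}$; $\Pi^\perp(a,b)[3..]$ if $|\{a,b\}\cap B|=2$ and $(a,b)\in\mathit{wdp}\cup\mathit{wdp}^{-1}$. *)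

theory Defs
  imports Main "HOL-Library.FuncSet"
begin

section \<open>Comtrace alphabets\<close>

record 'a alphabet =
  actions :: "'a set"
  sim :: "'a rel"
  ser :: "'a rel"

definition comtrace_alphabet :: "'a alphabet \<Rightarrow> bool" where
  "comtrace_alphabet \<Theta> \<longleftrightarrow>
     ser \<Theta> \<subseteq> sim \<Theta> \<and> sim \<Theta> \<subseteq> actions \<Theta> \<times> actions \<Theta> \<and> irrefl (sim \<Theta>) \<and> sym (sim \<Theta>)"

definition dep_rel :: "'a alphabet \<Rightarrow> 'a rel" where
  "dep_rel \<Theta> = (actions \<Theta> \<times> actions \<Theta>) - sim \<Theta>"

definition ind_rel :: "'a alphabet \<Rightarrow> 'a rel" where
  "ind_rel \<Theta> = ser \<Theta> \<inter> (ser \<Theta>)\<inverse>"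

definition sin_rel :: "'a alphabet \<Rightarrow> 'a rel" where
  "sin_rel \<Theta> = sim \<Theta> - ser \<Theta>"

definition ssm_rel :: "'a alphabet \<Rightarrow> 'a rel" where
  "ssm_rel \<Theta> = sim \<Theta> - (ser \<Theta> \<union> (ser \<Theta>)\<inverse>)"

definition wdp_rel :: "'a alphabet \<Rightarrow> 'a rel" where
  "wdp_rel \<Theta> = (ser \<Theta>)\<inverse> - ser \<Theta>"

section \<open>Step sequences and comtraces\<close>

text \<open>The set of actions is not required to be finite, but steps are; over a finite alphabet the
  finiteness condition on steps is void.\<close>

definition steps :: "'a alphabet \<Rightarrow> 'a set set" where
  "steps \<Theta> = {A. A \<noteq> {} \<and> finite A \<and> A \<subseteq> actions \<Theta> \<and>
                 (\<forall>a\<in>A. \<forall>b\<in>A. a \<noteq> b \<longrightarrow> (a, b) \<in> sim \<Theta>)}"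

definition step_seqs :: "'a alphabet \<Rightarrow> 'a set list set" where
  "step_seqs \<Theta> = lists (steps \<Theta>)"

definition comtrace_basic :: "'a alphabet \<Rightarrow> 'a set list \<Rightarrow> 'a set list \<Rightarrow> bool" where
  "comtrace_basic \<Theta> w v \<longleftrightarrow>
     (\<exists>u\<in>step_seqs \<Theta>. \<exists>z\<in>step_seqs \<Theta>. \<exists>A\<in>steps \<Theta>. \<exists>B\<in>steps \<Theta>.
        A \<times> B \<subseteq> ser \<Theta> \<and> w = u @ [A, B] @ z \<and> v = u @ [A \<union> B] @ z)"

definition comtrace_eq :: "'a alphabet \<Rightarrow> 'a set list rel" where
  "comtrace_eq \<Theta> =
     {(w, v). w \<in> step_seqs \<Theta> \<and> v \<in> step_seqs \<Theta> \<and> equivclp (comtrace_basic \<Theta>) w v}"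

definition comtraces :: "'a alphabet \<Rightarrow> 'a set list set set" where
  "comtraces \<Theta> = step_seqs \<Theta> // comtrace_eq \<Theta>"

definition comtrace_of :: "'a alphabet \<Rightarrow> 'a set list \<Rightarrow> 'a set list set" where
  "comtrace_of \<Theta> w = comtrace_eq \<Theta> `` {w}"

text \<open>The union is over representatives; all of them yield the same class.\<close>

definition comtrace_conc ::
  "'a alphabet \<Rightarrow> 'a set list set \<Rightarrow> 'a set list set \<Rightarrow> 'a set list set" where
  "comtrace_conc \<Theta> \<tau> \<sigma> = (\<Union>w\<in>\<tau>. \<Union>v\<in>\<sigma>. comtrace_of \<Theta> (w @ v))"

section \<open>Projection representation\<close>

text \<open>Words of a projection are over the actions extended by the symbol \<open>\<bottom>\<close>: an action \<open>a\<close> is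
  encoded as \<open>Some a\<close> and \<open>\<bottom>\<close> as \<open>None\<close>. For \<open>a = b\<close> the set \<open>{a, b}\<close> has a single element, so the
  second case applies.\<close>

definition proj_step :: "'a alphabet \<Rightarrow> 'a \<Rightarrow> 'a \<Rightarrow> 'a set \<Rightarrow> 'a option list" where
  "proj_step \<Theta> a b A =
     (if {a, b} \<inter> A = {} then []
      else if card ({a, b} \<inter> A) = 1 then [Some (the_elem ({a, b} \<inter> A))]
      else if (a, b) \<in> wdp_rel \<Theta> then [Some b, Some a]
      else if (b, a) \<in> wdp_rel \<Theta> then [Some a, Some b]
      else if (a, b) \<in> ssm_rel \<Theta> then [None]
      else undefined)"

definition proj_dom :: "'a alphabet \<Rightarrow> ('a \<times> 'a) set" where
  "proj_dom \<Theta> = (actions \<Theta> \<times> actions \<Theta>) - ind_rel \<Theta>"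

type_synonym 'a proj = "'a \<times> 'a \<Rightarrow> 'a option list"

definition seq_proj :: "'a alphabet \<Rightarrow> 'a set list \<Rightarrow> 'a proj" where
  "seq_proj \<Theta> w = restrict (\<lambda>(a, b). concat (map (proj_step \<Theta> a b) w)) (proj_dom \<Theta>)"

text \<open>The common projection representation of all members of a comtrace.\<close>

definition comtrace_proj :: "'a alphabet \<Rightarrow> 'a set list set \<Rightarrow> 'a proj" where
  "comtrace_proj \<Theta> \<tau> = the_elem (seq_proj \<Theta> ` \<tau>)"

section \<open>Possible actions\<close>

definition cond_possible :: "'a alphabet \<Rightarrow> 'a proj \<Rightarrow> 'a set" where
  "cond_possible \<Theta> P = {a \<in> actions \<Theta>. \<forall>b\<in>actions \<Theta>.
     ((a, b) \<in> dep_rel \<Theta> \<longrightarrow> take 1 (P (a, b)) = [Some a]) \<and>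
     ((b, a) \<in> wdp_rel \<Theta> \<longrightarrow> take 1 (P (a, b)) = [Some a]) \<and>
     ((a, b) \<in> wdp_rel \<Theta> \<longrightarrow> take 1 (P (a, b)) = [Some a] \<or> take 2 (P (a, b)) = [Some b, Some a]) \<and>
     ((a, b) \<in> ssm_rel \<Theta> \<longrightarrow> take 1 (P (a, b)) \<in> {[Some a], [None]})}"

definition cnd_rel :: "'a alphabet \<Rightarrow> 'a proj \<Rightarrow> 'a rel" where
  "cnd_rel \<Theta> P = {(a, b).
     ((a, b) \<in> wdp_rel \<Theta> \<and> take 2 (P (a, b)) = [Some b, Some a]) \<or>
     ((a, b) \<in> ssm_rel \<Theta> \<and> take 1 (P (a, b)) = [None])}"

inductive_set impossible :: "'a alphabet \<Rightarrow> 'a proj \<Rightarrow> 'a set"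
  for \<Theta> :: "'a alphabet" and P :: "'a proj" where
  base: "a \<in> actions \<Theta> - cond_possible \<Theta> P \<Longrightarrow> a \<in> impossible \<Theta> P"
| step: "b \<in> impossible \<Theta> P \<Longrightarrow> (a, b) \<in> cnd_rel \<Theta> P \<Longrightarrow> a \<in> impossible \<Theta> P"

definition possible_actions :: "'a alphabet \<Rightarrow> 'a proj \<Rightarrow> 'a set" where
  "possible_actions \<Theta> P = actions \<Theta> - impossible \<Theta> P"

section \<open>Indivisible steps and allowed sets\<close>

definition indivisible_steps :: "'a alphabet \<Rightarrow> 'a set set" where
  "indivisible_steps \<Theta> = {A \<in> steps \<Theta>. \<forall>a\<in>A. \<forall>b\<in>A.
     (a, b) \<in> (GREATEST E. equiv A E \<and> E \<subseteq> (Restr (sin_rel \<Theta>) A)\<^sup>*)}"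

text \<open>Steps are ordered first by size and then lexicographically. Comparing sizes first is what makes
  the least step sequence of a comtrace consist of indivisible steps: a divisible step \<open>A\<close> can be
  replaced by an equivalent sequence starting with a proper subset of \<open>A\<close>.\<close>

definition step_less :: "'a::linorder set rel" where
  "step_less = {(A, B). (sorted_list_of_set A, sorted_list_of_set B) \<in> lenlex {(x, y). x < y}}"

definition least_equiv_seq :: "'a::linorder alphabet \<Rightarrow> 'a set \<Rightarrow> 'a set list \<Rightarrow> bool" where
  "least_equiv_seq \<Theta> A w \<longleftrightarrow>
     w \<in> comtrace_of \<Theta> [A] \<and>
     (\<forall>v \<in> comtrace_of \<Theta> [A]. v = w \<or> (w, v) \<in> lexord step_less)"

definition step_indep :: "'a alphabet \<Rightarrow> 'a set rel" where
  "step_indep \<Theta> = {(C, D). C \<in> indivisible_steps \<Theta> \<and> D \<in> indivisible_steps \<Theta> \<and>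
                          C \<times> D \<subseteq> ind_rel \<Theta>}"

text \<open>Mazurkiewicz trace equivalence of words over a letter type with independence relation \<open>I\<close>.\<close>

definition trace_swap :: "'b rel \<Rightarrow> 'b list \<Rightarrow> 'b list \<Rightarrow> bool" where
  "trace_swap I w v \<longleftrightarrow> (\<exists>u z c d. (c, d) \<in> I \<and> w = u @ [c, d] @ z \<and> v = u @ [d, c] @ z)"

definition trace_eq :: "'b rel \<Rightarrow> 'b list \<Rightarrow> 'b list \<Rightarrow> bool" where
  "trace_eq I = equivclp (trace_swap I)"

text \<open>The word \<open>u\<close> represents a trace prefix of the trace of \<open>w\<close>.\<close>

definition trace_prefix :: "'b rel \<Rightarrow> 'b list \<Rightarrow> 'b list \<Rightarrow> bool" where
  "trace_prefix I u w \<longleftrightarrow> (\<exists>v. trace_eq I (u @ v) w)"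

definition allowed_sets :: "'a::linorder alphabet \<Rightarrow> 'a proj \<Rightarrow> 'a set set" where
  "allowed_sets \<Theta> P = {\<Union> (set u) | u w.
     least_equiv_seq \<Theta> (possible_actions \<Theta> P) w \<and> u \<noteq> [] \<and> trace_prefix (step_indep \<Theta>) u w}"

section \<open>Extraction\<close>

definition extr :: "'a alphabet \<Rightarrow> 'a proj \<Rightarrow> 'a set \<Rightarrow> 'a proj" where
  "extr \<Theta> P B = restrict (\<lambda>(a, b).
     if card ({a, b} \<inter> B) = 0 then P (a, b)
     else if card ({a, b} \<inter> B) = 1 then drop 1 (P (a, b))
     else if (a, b) \<in> ssm_rel \<Theta> then drop 1 (P (a, b))
     else if (a, b) \<in> wdp_rel \<Theta> \<union> (wdp_rel \<Theta>)\<inverse> then drop 2 (P (a, b))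
     else undefined) (proj_dom \<Theta>)"

end

theory Submission
  imports Defs
begin

text \<open>Call a set \<open>B\<close> of conditionally possible actions a front set if it is closed under \<open>cnd\<close>. A front
  set of the projections of \<open>w\<close> can be moved to the front of \<open>w\<close>, giving \<open>w \<equiv> Bv\<close>, by induction on
  \<open>w\<close>. The first step of any step sequence is a front set of its projections, so this also shows that
  the projections determine the comtrace. The set \<open>M\<close> of possible actions is the largest front set; an
  allowed set \<open>B\<close> satisfies \<open>B \<times> (M - B) \<subseteq> ser\<close>, and is therefore again a front set because \<open>cnd\<close> and
  \<open>ser\<close> are disjoint. Finally, extracting \<open>B\<close> from the projections of \<open>Bv\<close> leaves those of \<open>v\<close>.\<close>

section \<open>Steps and comtrace equivalence as a congruence\<close>

lemma steps_subset: "A \<in> steps \<Theta> \<Longrightarrow> C \<subseteq> A \<Longrightarrow> C \<noteq> {} \<Longrightarrow> C \<in> steps \<Theta>"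
  unfolding steps_def using finite_subset by auto blast+

lemma steps_Un:
  assumes "comtrace_alphabet \<Theta>" "A \<in> steps \<Theta>" "B \<in> steps \<Theta>" "A \<times> B \<subseteq> ser \<Theta>"
  shows "A \<union> B \<in> steps \<Theta>"
proof -
  have "(a, b) \<in> sim \<Theta>" if "a \<in> A \<union> B" "b \<in> A \<union> B" "a \<noteq> b" for a b
    using assms that unfolding comtrace_alphabet_def steps_def sym_def by blast
  then show ?thesis using assms unfolding steps_def by auto
qed

lemma Nil_in_step_seqs [simp]: "[] \<in> step_seqs \<Theta>"
  and Cons_in_step_seqs [simp]: "A # w \<in> step_seqs \<Theta> \<longleftrightarrow> A \<in> steps \<Theta> \<and> w \<in> step_seqs \<Theta>"
  and append_in_step_seqs [simp]:
    "w @ v \<in> step_seqs \<Theta> \<longleftrightarrow> w \<in> step_seqs \<Theta> \<and> v \<in> step_seqs \<Theta>"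
  by (auto simp: step_seqs_def)

lemma comtrace_eqD:
  assumes "(w, v) \<in> comtrace_eq \<Theta>"
  shows "w \<in> step_seqs \<Theta>" "v \<in> step_seqs \<Theta>"
  using assms by (auto simp: comtrace_eq_def)

lemma equiv_comtrace_eq: "equiv (step_seqs \<Theta>) (comtrace_eq \<Theta>)"
proof (rule equivI)
  show "comtrace_eq \<Theta> \<subseteq> step_seqs \<Theta> \<times> step_seqs \<Theta>"
    by (auto simp: comtrace_eq_def)
  show "refl_on (step_seqs \<Theta>) (comtrace_eq \<Theta>)"
    by (auto simp: comtrace_eq_def refl_on_def)
  show "sym (comtrace_eq \<Theta>)"
    by (auto simp: comtrace_eq_def sym_def intro: equivclp_sym)
  show "trans (comtrace_eq \<Theta>)"
    by (auto simp: comtrace_eq_def trans_def intro: equivclp_trans)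
qed

lemma comtrace_eq_refl: "w \<in> step_seqs \<Theta> \<Longrightarrow> (w, w) \<in> comtrace_eq \<Theta>"
  by (simp add: comtrace_eq_def)

lemma comtrace_eq_sym: "(w, v) \<in> comtrace_eq \<Theta> \<Longrightarrow> (v, w) \<in> comtrace_eq \<Theta>"
  by (auto simp: comtrace_eq_def intro: equivclp_sym)

lemma comtrace_eq_trans [trans]:
  "(w, v) \<in> comtrace_eq \<Theta> \<Longrightarrow> (v, x) \<in> comtrace_eq \<Theta> \<Longrightarrow> (w, x) \<in> comtrace_eq \<Theta>"
  by (auto simp: comtrace_eq_def intro: equivclp_trans)

lemma comtrace_basic_context:
  assumes "x \<in> step_seqs \<Theta>" "y \<in> step_seqs \<Theta>" "comtrace_basic \<Theta> w v"
  shows "comtrace_basic \<Theta> (x @ w @ y) (x @ v @ y)"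
proof -
  obtain u z A B where "u \<in> step_seqs \<Theta>" "z \<in> step_seqs \<Theta>" "A \<in> steps \<Theta>" "B \<in> steps \<Theta>"
    "A \<times> B \<subseteq> ser \<Theta>" "w = u @ [A, B] @ z" "v = u @ [A \<union> B] @ z"
    using assms(3) unfolding comtrace_basic_def by blast
  then show ?thesis
    unfolding comtrace_basic_def
    by (intro bexI[of _ "x @ u"] bexI[of _ "z @ y"] bexI[of _ A] bexI[of _ B])
      (use assms in auto)
qed

lemma comtrace_eq_context:
  assumes "x \<in> step_seqs \<Theta>" "y \<in> step_seqs \<Theta>" "(w, v) \<in> comtrace_eq \<Theta>"
  shows "(x @ w @ y, x @ v @ y) \<in> comtrace_eq \<Theta>"
proof -
  have "equivclp (comtrace_basic \<Theta>) (x @ w @ y) (x @ v @ y)"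
    if "equivclp (comtrace_basic \<Theta>) w v"
    using that
  proof (induction rule: equivclp_induct)
    case base
    then show ?case by simp
  next
    case (step v v')
    then have "comtrace_basic \<Theta> (x @ v @ y) (x @ v' @ y) \<or> comtrace_basic \<Theta> (x @ v' @ y) (x @ v @ y)"
      using comtrace_basic_context[OF assms(1,2)] by blast
    then show ?case using step.IH by (rule equivclp_into_equivclp[rotated])
  qed
  then show ?thesis using assms by (auto simp: comtrace_eq_def)
qed

lemma comtrace_eq_append:
  assumes "(w, v) \<in> comtrace_eq \<Theta>" "(w', v') \<in> comtrace_eq \<Theta>"
  shows "(w @ w', v @ v') \<in> comtrace_eq \<Theta>"
  using comtrace_eq_context[of "[]" \<Theta> w' w v] comtrace_eq_context[of v \<Theta> "[]" w' v'] assms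
  by (auto dest: comtrace_eqD intro: comtrace_eq_trans)

text \<open>The empty set is not a step; \<open>step_word\<close> lets the pieces of a split step be empty.\<close>

definition step_word :: "'a set \<Rightarrow> 'a set list" where
  "step_word A = (if A = {} then [] else [A])"

lemma step_word_in_step_seqs [simp]:
  "step_word A \<in> step_seqs \<Theta> \<longleftrightarrow> A = {} \<or> A \<in> steps \<Theta>"
  by (simp add: step_word_def)

lemma comtrace_eq_merge:
  assumes \<Theta>: "comtrace_alphabet \<Theta>" and A: "A = {} \<or> A \<in> steps \<Theta>" and B: "B = {} \<or> B \<in> steps \<Theta>"
    and ser: "A \<times> B \<subseteq> ser \<Theta>"
  shows "(step_word A @ step_word B, step_word (A \<union> B)) \<in> comtrace_eq \<Theta>"
proof (cases "A = {} \<or> B = {}")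
  case True
  then show ?thesis using A B by (auto simp: step_word_def intro: comtrace_eq_refl)
next
  case False
  then have AB: "A \<in> steps \<Theta>" "B \<in> steps \<Theta>" using A B by auto
  have "comtrace_basic \<Theta> [A, B] [A \<union> B]"
    unfolding comtrace_basic_def
    by (intro bexI[of _ "[]"] bexI[of _ A] bexI[of _ B]) (use AB ser in auto)
  then show ?thesis
    using False AB steps_Un[OF \<Theta> AB ser]
    by (auto simp: step_word_def comtrace_eq_def)
qed

text \<open>Independence gives \<open>ser\<close> in both directions, so both orders merge into the
  same step \<open>A \<union> B\<close>.\<close>

lemma comtrace_eq_commute:
  assumes \<Theta>: "comtrace_alphabet \<Theta>" and A: "A = {} \<or> A \<in> steps \<Theta>" and B: "B = {} \<or> B \<in> steps \<Theta>"
    and ind: "A \<times> B \<subseteq> ind_rel \<Theta>"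
  shows "(step_word A @ step_word B, step_word B @ step_word A) \<in> comtrace_eq \<Theta>"
proof -
  have "A \<times> B \<subseteq> ser \<Theta>" "B \<times> A \<subseteq> ser \<Theta>" using ind by (auto simp: ind_rel_def)
  then show ?thesis
    using comtrace_eq_merge[OF \<Theta> A B] comtrace_eq_merge[OF \<Theta> B A]
    by (metis comtrace_eq_sym comtrace_eq_trans sup_commute)
qed

section \<open>Projections and their invariance under comtrace equivalence\<close>

lemma ser_irrefl: "comtrace_alphabet \<Theta> \<Longrightarrow> (a, a) \<notin> ser \<Theta>"
  by (auto simp: comtrace_alphabet_def irrefl_def)

lemma steps_sim: "A \<in> steps \<Theta> \<Longrightarrow> a \<in> A \<Longrightarrow> b \<in> A \<Longrightarrow> a \<noteq> b \<Longrightarrow> (a, b) \<in> sim \<Theta>"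
  by (auto simp: steps_def)

text \<open>The diagonal projection records just the occurrences of \<open>a\<close>. Since
  \<open>ser\<close> is irreflexive, \<open>proj_dom\<close> contains the whole diagonal, so
  projections always reveal which actions occur.\<close>

lemma proj_step_same: "proj_step \<Theta> a a A = (if a \<in> A then [Some a] else [])"
  by (auto simp: proj_step_def)

lemma proj_step_neq:
  assumes "a \<noteq> b"
  shows "proj_step \<Theta> a b A =
    (if a \<in> A \<and> b \<in> A then
       (if (a, b) \<in> wdp_rel \<Theta> then [Some b, Some a]
        else if (b, a) \<in> wdp_rel \<Theta> then [Some a, Some b]
        else if (a, b) \<in> ssm_rel \<Theta> then [None] else undefined)
     else if a \<in> A then [Some a] else if b \<in> A then [Some b] else [])"
proof -
  have "{a, b} \<inter> A = (if a \<in> A \<and> b \<in> A then {a, b} else if a \<in> A then {a}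
    else if b \<in> A then {b} else {})"
    by auto
  then show ?thesis using assms by (auto simp: proj_step_def)
qed

text \<open>Dropping the restriction to \<open>proj_dom\<close> makes the concatenation laws hold
  for every pair.\<close>

definition proj_word :: "'a alphabet \<Rightarrow> 'a \<Rightarrow> 'a \<Rightarrow> 'a set list \<Rightarrow> 'a option list" where
  "proj_word \<Theta> a b w = concat (map (proj_step \<Theta> a b) w)"

lemma proj_word_simps [simp]:
  "proj_word \<Theta> a b [] = []"
  "proj_word \<Theta> a b (A # w) = proj_step \<Theta> a b A @ proj_word \<Theta> a b w"
  "proj_word \<Theta> a b (w @ v) = proj_word \<Theta> a b w @ proj_word \<Theta> a b v"
  by (simp_all add: proj_word_def)

lemma seq_proj_apply: "(a, b) \<in> proj_dom \<Theta> \<Longrightarrow> seq_proj \<Theta> w (a, b) = proj_word \<Theta> a b w"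
  by (simp add: seq_proj_def proj_word_def)

lemma seq_proj_eq_iff:
  "seq_proj \<Theta> w = seq_proj \<Theta> v \<longleftrightarrow>
    (\<forall>(a, b) \<in> proj_dom \<Theta>. proj_word \<Theta> a b w = proj_word \<Theta> a b v)"
  by (auto simp: seq_proj_def proj_word_def fun_eq_iff restrict_def)

lemma seq_proj_cancel:
  "seq_proj \<Theta> (u @ w) = seq_proj \<Theta> (u @ v) \<Longrightarrow> seq_proj \<Theta> w = seq_proj \<Theta> v"
  by (auto simp: seq_proj_eq_iff)

text \<open>Irreflexivity of \<open>ser\<close> makes \<open>A\<close> and \<open>B\<close>
  disjoint. If \<open>a\<close> is in \<open>A\<close> and \<open>b\<close> in \<open>B\<close>,
  then \<open>(a, b)\<close> lies in \<open>ser\<close> but not in \<open>ind_rel\<close>, hence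
  \<open>(b, a)\<close> is in \<open>wdp_rel\<close>, and the joint step is projected to
  \<open>ab\<close>, just as \<open>A\<close> followed by \<open>B\<close>.\<close>

lemma comtrace_basic_proj:
  assumes \<Theta>: "comtrace_alphabet \<Theta>" and "comtrace_basic \<Theta> w v"
  shows "seq_proj \<Theta> w = seq_proj \<Theta> v"
proof -
  obtain u z A B where AB: "A \<in> steps \<Theta>" "B \<in> steps \<Theta>"
    "A \<times> B \<subseteq> ser \<Theta>" "w = u @ [A, B] @ z" "v = u @ [A \<union> B] @ z"
    using assms(2) unfolding comtrace_basic_def by blast
  have disj: "A \<inter> B = {}" using AB ser_irrefl[OF \<Theta>] by blast
  have "proj_step \<Theta> a b A @ proj_step \<Theta> a b B = proj_step \<Theta> a b (A \<union> B)"
    if "(a, b) \<in> proj_dom \<Theta>" for a b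
  proof (cases "a = b")
    case True
    then show ?thesis using disj by (auto simp: proj_step_same)
  next
    case False
    have "a \<in> A \<Longrightarrow> b \<in> B \<Longrightarrow> (a, b) \<in> ser \<Theta>" "b \<in> A \<Longrightarrow> a \<in> B \<Longrightarrow> (b, a) \<in> ser \<Theta>"
      using AB by auto
    then show ?thesis using False that disj
      by (auto simp: proj_step_neq proj_dom_def ind_rel_def wdp_rel_def)
  qed
  then show ?thesis using AB by (auto simp: seq_proj_eq_iff)
qed

lemma comtrace_eq_proj:
  assumes \<Theta>: "comtrace_alphabet \<Theta>" and "(w, v) \<in> comtrace_eq \<Theta>"
  shows "seq_proj \<Theta> w = seq_proj \<Theta> v"
proof -
  have "equivclp (comtrace_basic \<Theta>) w v" using assms by (simp add: comtrace_eq_def)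
  then show ?thesis
  proof (induction rule: equivclp_induct)
    case (step v v')
    then show ?case using comtrace_basic_proj[OF \<Theta>] by metis
  qed simp
qed

section \<open>Front sets and moving them to the front of a word\<close>

definition front_set :: "'a alphabet \<Rightarrow> 'a proj \<Rightarrow> 'a set \<Rightarrow> bool" where
  "front_set \<Theta> P B \<longleftrightarrow> B \<subseteq> cond_possible \<Theta> P \<and> (\<forall>a\<in>B. \<forall>b. (a, b) \<in> cnd_rel \<Theta> P \<longrightarrow> b \<in> B)"

text \<open>The case \<open>a = b\<close> falls under \<open>dep_rel\<close> because
  \<open>sim\<close> is irreflexive. Only the independent pairs have no projection.\<close>

lemma actions_rel_cases:
  assumes "comtrace_alphabet \<Theta>" "a \<in> actions \<Theta>" "b \<in> actions \<Theta>"
  obtains "(a, b) \<in> dep_rel \<Theta>" "(a, b) \<in> proj_dom \<Theta>" "(a, b) \<notin> sim \<Theta>"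
  | "(a, b) \<in> wdp_rel \<Theta>" "(a, b) \<in> proj_dom \<Theta>" "a \<noteq> b"
  | "(b, a) \<in> wdp_rel \<Theta>" "(a, b) \<in> proj_dom \<Theta>" "a \<noteq> b"
  | "(a, b) \<in> ssm_rel \<Theta>" "(a, b) \<in> proj_dom \<Theta>" "a \<noteq> b"
  | "(a, b) \<in> ind_rel \<Theta>" "a \<noteq> b"
  using assms ser_irrefl[OF assms(1)]
  unfolding dep_rel_def wdp_rel_def ssm_rel_def ind_rel_def proj_dom_def comtrace_alphabet_def
    irrefl_def
  by blast

lemma rel_actions:
  assumes "comtrace_alphabet \<Theta>"
  shows "(a, b) \<in> wdp_rel \<Theta> \<Longrightarrow> a \<in> actions \<Theta> \<and> b \<in> actions \<Theta> \<and> a \<noteq> b \<and> (a, b) \<notin> ssm_rel \<Theta> \<and>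
      (b, a) \<notin> wdp_rel \<Theta> \<and> (a, b) \<in> proj_dom \<Theta> \<and> (b, a) \<in> proj_dom \<Theta> \<and>
      (a, b) \<notin> dep_rel \<Theta> \<and> (b, a) \<notin> dep_rel \<Theta>"
    "(a, b) \<in> ssm_rel \<Theta> \<Longrightarrow> a \<in> actions \<Theta> \<and> b \<in> actions \<Theta> \<and> a \<noteq> b \<and>
      (a, b) \<notin> wdp_rel \<Theta> \<and> (b, a) \<notin> wdp_rel \<Theta> \<and> (a, b) \<in> proj_dom \<Theta> \<and> (a, b) \<notin> dep_rel \<Theta>"
  using assms ser_irrefl[OF assms(1)]
  unfolding dep_rel_def wdp_rel_def ssm_rel_def ind_rel_def proj_dom_def comtrace_alphabet_def
    irrefl_def sym_def
  by blast+

text \<open>This is the induction step for moving \<open>B\<close> forward past a first step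
  \<open>A\<close>. The first three claims license the splitting, commuting and merging of the
  pieces; the fourth lets the induction continue with what \<open>A\<close> does not yet contain of
  \<open>B\<close>. For the first claim, a pair in \<open>A\<close> outside \<open>ser\<close> shows
  the pattern \<open>ba\<close> or the bottom symbol and is thus a \<open>cnd\<close> pair, which
  closure of \<open>B\<close> forbids.\<close>

lemma front_set_split:
  assumes \<Theta>: "comtrace_alphabet \<Theta>" and A: "A \<in> steps \<Theta>"
    and B: "front_set \<Theta> (seq_proj \<Theta> (A # w)) B"
  shows "(A \<inter> B) \<times> (A - B) \<subseteq> ser \<Theta>" (is ?thesis1)
    and "(A - B) \<times> (B - A) \<subseteq> ind_rel \<Theta>" (is ?thesis2)
    and "(A \<inter> B) \<times> (B - A) \<subseteq> ser \<Theta>" (is ?thesis3)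
    and "front_set \<Theta> (seq_proj \<Theta> w) (B - A)" (is ?thesis4)
proof -
  let ?P = "seq_proj \<Theta> (A # w)"
  have cpa: "a \<in> cond_possible \<Theta> ?P" and act: "a \<in> actions \<Theta>" if "a \<in> B" for a
    using B that by (auto simp: front_set_def cond_possible_def)
  have cnd: "b \<in> B" if "a \<in> B" "(a, b) \<in> cnd_rel \<Theta> ?P" for a b
    using B that by (auto simp: front_set_def)
  have actA: "A \<subseteq> actions \<Theta>" using A by (auto simp: steps_def)
  have inner: "(a, b) \<in> ser \<Theta>" if "a \<in> A" "a \<in> B" "b \<in> A" "b \<notin> B" for a b
  proof -
    have "a \<in> actions \<Theta>" "b \<in> actions \<Theta>" "(a, b) \<in> sim \<Theta>"
      using that actA steps_sim[OF A] by blast+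
    with \<Theta> show ?thesis
    proof (cases rule: actions_rel_cases)
      case 2
      then show ?thesis using cnd[of a b] that
        by (auto simp: cnd_rel_def seq_proj_apply proj_step_neq)
    next
      case 4
      then show ?thesis using cnd[of a b] that rel_actions(2)[OF \<Theta> 4(1)]
        by (auto simp: cnd_rel_def seq_proj_apply proj_step_neq)
    qed (auto simp: wdp_rel_def ind_rel_def)
  qed
  then show ?thesis1 by blast
  \<comment> \<open>The projection to \<open>a\<close> and \<open>b\<close> starts with
    \<open>b\<close>, contributed by \<open>A\<close>. Conditional possibility of \<open>a\<close>
    rules this out for \<open>dep_rel\<close>, \<open>ssm_rel\<close> and
    \<open>(b, a) \<in> wdp_rel\<close>. For \<open>(a, b) \<in> wdp_rel\<close> it forces the start
    \<open>ba\<close>: this is a \<open>cnd\<close> pair, so \<open>b\<close> is in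
    \<open>B\<close>, and \<open>a\<close> comes first once \<open>A\<close> is removed.\<close>
  have outer: "(a, b) \<in> ind_rel \<Theta> \<or>
      ((a, b) \<in> wdp_rel \<Theta> \<and> b \<in> B \<and> take 1 (proj_word \<Theta> a b w) = [Some a])"
    if "a \<in> B" "a \<notin> A" "b \<in> A" for a b
  proof -
    have ab: "a \<in> actions \<Theta>" "b \<in> actions \<Theta>" "a \<noteq> b" using that actA act by blast+
    from \<Theta> ab(1,2) show ?thesis
    proof (cases rule: actions_rel_cases)
      case 2
      then have "take 1 (proj_word \<Theta> a b w) = [Some a]"
        using cpa[OF that(1)] that ab
        by (auto simp: cond_possible_def seq_proj_apply proj_step_neq numeral_2_eq_2)
      moreover from this have "b \<in> B" using cnd[of a b] that ab 2
        by (auto simp: cnd_rel_def seq_proj_apply proj_step_neq numeral_2_eq_2)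
      ultimately show ?thesis using 2 by blast
    qed (use cpa[OF that(1)] that ab in \<open>auto simp: cond_possible_def seq_proj_apply proj_step_neq\<close>)
  qed
  have "(b, a) \<in> ind_rel \<Theta>" if "a \<in> B" "a \<notin> A" "b \<in> A" "b \<notin> B" for a b
    using outer[OF that(1-3)] that by (auto simp: ind_rel_def)
  then show ?thesis2 by blast
  have "(b, a) \<in> ser \<Theta>" if "a \<in> B" "a \<notin> A" "b \<in> A" for a b
    using outer[OF that] by (auto simp: ind_rel_def wdp_rel_def)
  then show ?thesis3 by blast
  have same: "seq_proj \<Theta> w (a, b) = ?P (a, b)" if "a \<notin> A" "b \<notin> A" for a b
    using that by (auto simp: seq_proj_def proj_step_def)
  show ?thesis4
    unfolding front_set_def
  proof (intro conjI ballI allI impI subsetI)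
    fix a assume "a \<in> B - A"
    then have a: "a \<in> B" "a \<notin> A" by auto
    have "((a, b) \<in> dep_rel \<Theta> \<longrightarrow> take 1 (seq_proj \<Theta> w (a, b)) = [Some a]) \<and>
     ((b, a) \<in> wdp_rel \<Theta> \<longrightarrow> take 1 (seq_proj \<Theta> w (a, b)) = [Some a]) \<and>
     ((a, b) \<in> wdp_rel \<Theta> \<longrightarrow> take 1 (seq_proj \<Theta> w (a, b)) = [Some a] \<or>
       take 2 (seq_proj \<Theta> w (a, b)) = [Some b, Some a]) \<and>
     ((a, b) \<in> ssm_rel \<Theta> \<longrightarrow> take 1 (seq_proj \<Theta> w (a, b)) \<in> {[Some a], [None]})"
      if "b \<in> actions \<Theta>" for b
    proof (cases "b \<in> A")
      case False
      then show ?thesis using cpa[OF a(1)] that by (simp add: same a cond_possible_def)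
    next
      \<comment> \<open>An independent pair imposes no condition. A weakly dependent one has
        \<open>a\<close> as its first letter in \<open>w\<close>, which is the first of the two
        permitted starts.\<close>
      case True
      from outer[OF a True] show ?thesis
      proof (elim disjE conjE)
        assume "(a, b) \<in> ind_rel \<Theta>"
        then show ?thesis using \<Theta>
          by (auto simp: ind_rel_def wdp_rel_def dep_rel_def ssm_rel_def comtrace_alphabet_def)
      next
        assume "(a, b) \<in> wdp_rel \<Theta>" "take 1 (proj_word \<Theta> a b w) = [Some a]"
        then show ?thesis using rel_actions(1)[OF \<Theta>] by (auto simp: seq_proj_apply)
      qed
    qed
    then show "a \<in> cond_possible \<Theta> (seq_proj \<Theta> w)" using act[OF a(1)] by (simp add: cond_possible_def)
  next
    fix a b assume "a \<in> B - A" and ab: "(a, b) \<in> cnd_rel \<Theta> (seq_proj \<Theta> w)"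
    then have a: "a \<in> B" "a \<notin> A" by auto
    show "b \<in> B - A"
    proof (cases "b \<in> A")
      case False
      then have "(a, b) \<in> cnd_rel \<Theta> ?P" using ab by (auto simp: cnd_rel_def same a)
      then show ?thesis using cnd a False by blast
    next
      \<comment> \<open>This case is contradictory: with \<open>A\<close> removed, the projection
        starts with \<open>a\<close> instead of \<open>b\<close>, so the pair is no longer in
        \<open>cnd_rel\<close>.\<close>
      case True
      from outer[OF a True] show ?thesis
      proof (elim disjE conjE)
        assume "(a, b) \<in> ind_rel \<Theta>"
        then show ?thesis using ab by (auto simp: cnd_rel_def ind_rel_def wdp_rel_def ssm_rel_def)
      next
        assume "(a, b) \<in> wdp_rel \<Theta>" "take 1 (proj_word \<Theta> a b w) = [Some a]"
        then show ?thesis using ab rel_actions(1)[OF \<Theta>, of a b]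
          by (cases "proj_word \<Theta> a b w") (auto simp: cnd_rel_def seq_proj_apply)
      qed
    qed
  qed
qed

text \<open>The first step \<open>A\<close> splits as \<open>(A \<inter> B)(A - B)\<close>, induction brings \<open>B - A\<close> to the front of the
  remaining word, \<open>A - B\<close> commutes with \<open>B - A\<close>, and \<open>A \<inter> B\<close> merges with \<open>B - A\<close> into \<open>B\<close>.\<close>

lemma front_set_comtrace_eq:
  assumes \<Theta>: "comtrace_alphabet \<Theta>" and "w \<in> step_seqs \<Theta>" "front_set \<Theta> (seq_proj \<Theta> w) B"
  shows "\<exists>v. (w, step_word B @ v) \<in> comtrace_eq \<Theta>"
  using assms(2,3)
proof (induction w arbitrary: B)
  case Nil
  \<comment> \<open>Every action depends on itself, so \<open>b = a\<close> is the witness: the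
    empty diagonal projection has no first letter.\<close>
  have "a \<notin> cond_possible \<Theta> (seq_proj \<Theta> [])" for a
    using \<Theta> by (auto simp: cond_possible_def seq_proj_def restrict_def dep_rel_def proj_dom_def
      ind_rel_def comtrace_alphabet_def irrefl_def intro!: bexI[of _ a])
  then have "B = {}" using Nil by (auto simp: front_set_def)
  then show ?case by (auto simp: step_word_def intro!: exI[of _ "[]"] comtrace_eq_refl)
next
  case (Cons A w)
  then have A: "A \<in> steps \<Theta>" and w: "w \<in> step_seqs \<Theta>" by auto
  note split = front_set_split[OF \<Theta> A Cons.prems(2)]
  obtain v where v: "(w, step_word (B - A) @ v) \<in> comtrace_eq \<Theta>"
    using Cons.IH[OF w split(4)] by blast
  \<comment> \<open>A front set is not assumed to be a step; that \<open>B - A\<close> is empty or a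
    step follows from its occurrence in a word equivalent to \<open>w\<close>.\<close>
  have BA: "B - A = {} \<or> B - A \<in> steps \<Theta>" and v': "v \<in> step_seqs \<Theta>"
    using comtrace_eqD(2)[OF v] by auto
  have AB: "A - B = {} \<or> A - B \<in> steps \<Theta>" and C: "A \<inter> B = {} \<or> A \<inter> B \<in> steps \<Theta>"
    using steps_subset[OF A] by auto
  have "A \<inter> B \<union> (A - B) = A" by blast
  then have "([A], step_word (A \<inter> B) @ step_word (A - B)) \<in> comtrace_eq \<Theta>"
    using comtrace_eq_sym[OF comtrace_eq_merge[OF \<Theta> C AB split(1)]] A
    by (auto simp: step_word_def steps_def)
  from comtrace_eq_append[OF this v]
  have "(A # w, step_word (A \<inter> B) @ (step_word (A - B) @ step_word (B - A)) @ v) \<in> comtrace_eq \<Theta>"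
    by simp
  also have "(step_word (A \<inter> B) @ (step_word (A - B) @ step_word (B - A)) @ v,
      step_word (A \<inter> B) @ (step_word (B - A) @ step_word (A - B)) @ v) \<in> comtrace_eq \<Theta>"
    by (rule comtrace_eq_context[OF _ v' comtrace_eq_commute[OF \<Theta> AB BA split(2)]]) (use C in simp)
  also have "A \<inter> B \<union> (B - A) = B" by blast
  then have "(step_word (A \<inter> B) @ (step_word (B - A) @ step_word (A - B)) @ v,
      step_word B @ step_word (A - B) @ v) \<in> comtrace_eq \<Theta>"
    using comtrace_eq_append[OF comtrace_eq_merge[OF \<Theta> C BA split(3)]
      comtrace_eq_refl[of "step_word (A - B) @ v"]] AB v' by simp
  finally show ?case by blast
qed

section \<open>Projections determine the comtrace\<close>

text \<open>The starts tolerated by \<open>cond_possible\<close> are those that a step containing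
  \<open>a\<close> can produce. A \<open>cnd\<close> pattern requires both actions in the first
  step: if \<open>b\<close> is missing, the projection begins with the plain letter
  \<open>a\<close>.\<close>

lemma front_set_first_step:
  assumes \<Theta>: "comtrace_alphabet \<Theta>" and B: "B \<in> steps \<Theta>"
  shows "front_set \<Theta> (seq_proj \<Theta> (B # w)) B"
proof -
  have sim: "(a, b) \<notin> dep_rel \<Theta>" if "a \<in> B" "b \<in> B" "a \<noteq> b" for a b
    using steps_sim[OF B that] by (auto simp: dep_rel_def)
  have dom: "(a, b) \<in> dep_rel \<Theta> \<Longrightarrow> (a, b) \<in> proj_dom \<Theta>" for a b
    using \<Theta> by (auto simp: dep_rel_def proj_dom_def ind_rel_def comtrace_alphabet_def)
  have act: "B \<subseteq> actions \<Theta>" using B by (auto simp: steps_def)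
  show ?thesis
    unfolding front_set_def
  proof (intro conjI ballI allI impI subsetI)
    fix a assume a: "a \<in> B"
    have "take 1 (seq_proj \<Theta> (B # w) (a, b)) = [Some a]" if "(a, b) \<in> dep_rel \<Theta>" for b
      using sim[OF a, of b] dom[OF that] that a
      by (cases "a = b") (auto simp: seq_proj_apply proj_step_same proj_step_neq)
    moreover have "take 1 (seq_proj \<Theta> (B # w) (a, b)) = [Some a]" if "(b, a) \<in> wdp_rel \<Theta>" for b
      using rel_actions(1)[OF \<Theta> that] that a by (auto simp: seq_proj_apply proj_step_neq)
    moreover have "take 1 (seq_proj \<Theta> (B # w) (a, b)) = [Some a] \<or>
        take 2 (seq_proj \<Theta> (B # w) (a, b)) = [Some b, Some a]" if "(a, b) \<in> wdp_rel \<Theta>" for b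
      using rel_actions(1)[OF \<Theta> that] that a by (auto simp: seq_proj_apply proj_step_neq)
    moreover have "take 1 (seq_proj \<Theta> (B # w) (a, b)) \<in> {[Some a], [None]}"
      if "(a, b) \<in> ssm_rel \<Theta>" for b
      using rel_actions(2)[OF \<Theta> that] that a by (auto simp: seq_proj_apply proj_step_neq)
    ultimately show "a \<in> cond_possible \<Theta> (seq_proj \<Theta> (B # w))"
      using a act by (auto simp: cond_possible_def)
  next
    fix a b assume a: "a \<in> B" and ab: "(a, b) \<in> cnd_rel \<Theta> (seq_proj \<Theta> (B # w))"
    then have "(a, b) \<in> proj_dom \<Theta>" "a \<noteq> b"
      using rel_actions[OF \<Theta>, of a b] by (auto simp: cnd_rel_def)
    then show "b \<in> B" using a ab
      by (rule_tac ccontr) (auto simp: cnd_rel_def seq_proj_apply proj_step_neq)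
  qed
qed

lemma seq_proj_Nil:
  assumes \<Theta>: "comtrace_alphabet \<Theta>" and "w \<in> step_seqs \<Theta>" "seq_proj \<Theta> w = seq_proj \<Theta> []"
  shows "w = []"
proof (cases w)
  case (Cons A v)
  then obtain a where a: "a \<in> A" "a \<in> actions \<Theta>" using assms(2) by (auto simp: steps_def)
  then have "(a, a) \<in> proj_dom \<Theta>" using ser_irrefl[OF \<Theta>] by (auto simp: proj_dom_def ind_rel_def)
  then have "proj_word \<Theta> a a w = []" using assms(3) by (auto simp: seq_proj_eq_iff)
  then show ?thesis using a Cons by (simp add: proj_step_same)
qed

text \<open>For the converse direction, the first step \<open>B\<close> of \<open>v\<close> is a
  front set for \<open>w\<close> too, as the projections agree. So \<open>w\<close> is equivalent to
  some \<open>B # w'\<close>, and cancelling the contribution of \<open>B\<close> leaves equal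
  projections for the induction hypothesis.\<close>

theorem comtrace_eq_iff_seq_proj_eq:
  assumes \<Theta>: "comtrace_alphabet \<Theta>" and "w \<in> step_seqs \<Theta>" "v \<in> step_seqs \<Theta>"
  shows "(w, v) \<in> comtrace_eq \<Theta> \<longleftrightarrow> seq_proj \<Theta> w = seq_proj \<Theta> v"
proof
  show "(w, v) \<in> comtrace_eq \<Theta>" if "seq_proj \<Theta> w = seq_proj \<Theta> v"
    using assms(2,3) that
  proof (induction v arbitrary: w)
    case Nil
    then show ?case using seq_proj_Nil[OF \<Theta>] by (auto intro: comtrace_eq_refl)
  next
    case (Cons B v)
    then have B: "B \<in> steps \<Theta>" and v: "v \<in> step_seqs \<Theta>" by auto
    obtain w' where "(w, step_word B @ w') \<in> comtrace_eq \<Theta>"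
      using front_set_comtrace_eq[OF \<Theta> Cons.prems(1)] front_set_first_step[OF \<Theta> B, of v]
        Cons.prems(3) by metis
    then have w': "(w, [B] @ w') \<in> comtrace_eq \<Theta>" using B by (auto simp: step_word_def steps_def)
    then have "seq_proj \<Theta> w' = seq_proj \<Theta> v"
      using comtrace_eq_proj[OF \<Theta> w'] Cons.prems(3) seq_proj_cancel[of \<Theta> "[B]" w' v] by simp
    then have "(w', v) \<in> comtrace_eq \<Theta>"
      using Cons.IH[OF _ v] comtrace_eqD(2)[OF w'] by simp
    from comtrace_eq_append[OF comtrace_eq_refl[of "[B]"] this] show ?case
      using w' B comtrace_eq_trans by fastforce
  qed
qed (rule comtrace_eq_proj[OF \<Theta>])

section \<open>Extraction removes a first step\<close>

text \<open>The number of letters dropped is the length of the projection of \<open>B\<close>: the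
  bottom symbol stands for two actions but is one letter, and a diagonal pair meets \<open>B\<close>
  in at most one element.\<close>

lemma extr_seq_proj_Cons:
  fixes \<Theta> :: "'a alphabet"
  assumes \<Theta>: "comtrace_alphabet \<Theta>" and B: "B \<in> steps \<Theta>"
  shows "extr \<Theta> (seq_proj \<Theta> (B # w)) B = seq_proj \<Theta> w"
proof
  fix p :: "'a \<times> 'a"
  obtain a b where p: "p = (a, b)" by (cases p)
  show "extr \<Theta> (seq_proj \<Theta> (B # w)) B p = seq_proj \<Theta> w p"
  proof (cases "(a, b) \<in> proj_dom \<Theta>")
    case False
    then show ?thesis by (simp add: p extr_def seq_proj_def)
  next
    case dom: True
    show ?thesis
    proof (cases "a = b")
      case True
      then show ?thesis using dom by (auto simp: p extr_def seq_proj_apply proj_step_same)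
    next
      case False
      have cap: "{a, b} \<inter> B = (if a \<in> B \<and> b \<in> B then {a, b} else if a \<in> B then {a}
        else if b \<in> B then {b} else {})"
        by auto
      \<comment> \<open>This excludes the \<open>undefined\<close> branches of both
        \<open>extr\<close> and \<open>proj_step\<close>.\<close>
      have "(a, b) \<in> wdp_rel \<Theta> \<or> (b, a) \<in> wdp_rel \<Theta> \<or> (a, b) \<in> ssm_rel \<Theta>" if "a \<in> B" "b \<in> B"
        using steps_sim[OF B that False] dom
        by (auto simp: wdp_rel_def ssm_rel_def proj_dom_def ind_rel_def)
      \<comment> \<open>\<open>extr\<close> tests \<open>ssm_rel\<close> first,
        \<open>proj_step\<close> tests \<open>wdp_rel\<close> first; disjointness makes the two case
        distinctions agree.\<close>
      moreover have "(a, b) \<notin> ssm_rel \<Theta>" if "(a, b) \<in> wdp_rel \<Theta> \<or> (b, a) \<in> wdp_rel \<Theta>"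
        using that by (auto simp: wdp_rel_def ssm_rel_def)
      ultimately show ?thesis using False dom
        by (auto simp: p extr_def seq_proj_apply cap proj_step_neq)
    qed
  qed
qed

section \<open>Possible actions and allowed sets\<close>

lemma cnd_rel_not_ser: "(a, b) \<in> cnd_rel \<Theta> P \<Longrightarrow> (a, b) \<notin> ser \<Theta>"
  by (auto simp: cnd_rel_def wdp_rel_def ssm_rel_def)

text \<open>\<open>impossible\<close> is closed backwards along \<open>cnd_rel\<close>, so its
  complement in the actions is closed forwards.\<close>

lemma possible_actions_front_set:
  assumes \<Theta>: "comtrace_alphabet \<Theta>"
  shows "front_set \<Theta> P (possible_actions \<Theta> P)"
  unfolding front_set_def
proof (intro conjI ballI allI impI subsetI)
  fix a assume "a \<in> possible_actions \<Theta> P"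
  then show "a \<in> cond_possible \<Theta> P"
    using impossible.base[of a \<Theta> P] unfolding possible_actions_def by blast
next
  fix a b assume a: "a \<in> possible_actions \<Theta> P" and ab: "(a, b) \<in> cnd_rel \<Theta> P"
  have "b \<in> actions \<Theta>"
    using ab rel_actions[OF \<Theta>, of a b] unfolding cnd_rel_def by blast
  then show "b \<in> possible_actions \<Theta> P"
    using a impossible.step[OF _ ab] unfolding possible_actions_def by blast
qed

lemma front_set_subset:
  assumes "front_set \<Theta> P M" "B \<subseteq> M" "B \<times> (M - B) \<subseteq> ser \<Theta>"
  shows "front_set \<Theta> P B"
  unfolding front_set_def
proof (intro conjI ballI allI impI)
  show "B \<subseteq> cond_possible \<Theta> P" using assms unfolding front_set_def by blast
next
  fix a b assume "a \<in> B" and ab: "(a, b) \<in> cnd_rel \<Theta> P"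
  then have "b \<in> M" using assms unfolding front_set_def by blast
  then show "b \<in> B" using assms(3) \<open>a \<in> B\<close> cnd_rel_not_ser[OF ab] by blast
qed

text \<open>Swapping independent indivisible steps is an instance of commuting two steps with all
  cross pairs independent.\<close>

lemma trace_eq_comtrace_eq:
  assumes \<Theta>: "comtrace_alphabet \<Theta>" and "trace_eq (step_indep \<Theta>) w v" "v \<in> step_seqs \<Theta>"
  shows "(w, v) \<in> comtrace_eq \<Theta>"
proof -
  \<comment> \<open>One end suffices, since a swap keeps the letters. Starting the induction at
    \<open>v\<close>, the only word known to be a step sequence, therefore carries this property
    along the chain.\<close>
  have swap: "(x, y) \<in> comtrace_eq \<Theta>"
    if xy: "trace_swap (step_indep \<Theta>) x y" "x \<in> step_seqs \<Theta> \<or> y \<in> step_seqs \<Theta>" for x y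
  proof -
    obtain u z C D where *: "(C, D) \<in> step_indep \<Theta>" "x = u @ [C, D] @ z" "y = u @ [D, C] @ z"
      using xy(1) unfolding trace_swap_def by blast
    have CD: "C \<in> steps \<Theta>" "D \<in> steps \<Theta>" "C \<times> D \<subseteq> ind_rel \<Theta>" "C \<noteq> {}" "D \<noteq> {}"
      using * by (auto simp: step_indep_def indivisible_steps_def steps_def)
    have uz: "u \<in> step_seqs \<Theta>" "z \<in> step_seqs \<Theta>" using xy(2) * by auto
    have "([C, D], [D, C]) \<in> comtrace_eq \<Theta>"
      using comtrace_eq_commute[OF \<Theta>, of C D] CD by (simp add: step_word_def)
    from comtrace_eq_context[OF uz this] show ?thesis using * by simp
  qed
  have "equivclp (trace_swap (step_indep \<Theta>)) w v" using assms(2) by (simp add: trace_eq_def)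
  then show ?thesis
  proof (induction rule: converse_equivclp_induct)
    case base
    then show ?case using assms(3) by (rule comtrace_eq_refl)
  next
    case (step y z)
    then have "(y, z) \<in> comtrace_eq \<Theta>"
      using swap comtrace_eqD(1)[OF step.IH] comtrace_eq_sym by blast
    then show ?case using step.IH by (rule comtrace_eq_trans)
  qed
qed

lemma proj_word_same: "proj_word \<Theta> a a w = [] \<longleftrightarrow> a \<notin> \<Union> (set w)"
  by (induction w) (auto simp: proj_step_same)

lemma take_proj_word:
  assumes "a \<noteq> b" "a \<in> \<Union> (set w)" "b \<notin> \<Union> (set w)"
  shows "\<exists>x. proj_word \<Theta> a b w = Some a # x"
  using assms by (induction w) (auto simp: proj_step_neq)

text \<open>The word \<open>u @ v\<close> has the projections of the single step \<open>M\<close>.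
  If \<open>a\<close> occurs in \<open>u\<close> and \<open>b\<close> only later, the projection
  starts with \<open>a\<close>. But \<open>M\<close> contains both, so it would yield
  \<open>ba\<close> for \<open>(a, b) \<in> wdp_rel\<close> and the bottom symbol for
  \<open>ssm_rel\<close>; only pairs in \<open>ser\<close> remain.\<close>

lemma comtrace_eq_single_prefix:
  assumes \<Theta>: "comtrace_alphabet \<Theta>" and eq: "(u @ v, [M]) \<in> comtrace_eq \<Theta>" and "u \<noteq> []"
  defines "B \<equiv> \<Union> (set u)"
  shows "B \<subseteq> M" "B \<times> (M - B) \<subseteq> ser \<Theta>" "B \<noteq> {}"
proof -
  have M: "M \<in> steps \<Theta>" and u: "u \<in> step_seqs \<Theta>" and v: "v \<in> step_seqs \<Theta>"
    using comtrace_eqD[OF eq] by auto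
  have proj: "proj_word \<Theta> a b (u @ v) = proj_step \<Theta> a b M" if "(a, b) \<in> proj_dom \<Theta>" for a b
    using comtrace_eq_proj[OF \<Theta> eq] that by (auto simp: seq_proj_eq_iff)
  have act: "M \<subseteq> actions \<Theta>" "B \<subseteq> actions \<Theta>"
    using M u by (auto simp: steps_def step_seqs_def B_def)
  show BM: "B \<subseteq> M"
  proof
    fix a assume a: "a \<in> B"
    then have "(a, a) \<in> proj_dom \<Theta>"
      using act ser_irrefl[OF \<Theta>] by (auto simp: proj_dom_def ind_rel_def)
    from proj[OF this] proj_word_same[of \<Theta> a "u @ v"] a have "proj_step \<Theta> a a M \<noteq> []"
      by (auto simp: B_def simp del: proj_word_simps)
    then show "a \<in> M" by (auto simp: proj_step_same split: if_splits)
  qed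
  have "(a, b) \<in> ser \<Theta>" if in_B: "a \<in> B" "b \<in> M" "b \<notin> B" for a b
  proof -
    have ab: "a \<in> M" "a \<noteq> b" "a \<in> actions \<Theta>" "b \<in> actions \<Theta>" using in_B BM act by blast+
    have sim: "(a, b) \<in> sim \<Theta>" using steps_sim[OF M ab(1) in_B(2) ab(2)] .
    obtain x where x: "proj_word \<Theta> a b u = Some a # x"
      using take_proj_word[of a b u \<Theta>] in_B ab unfolding B_def by blast
    from \<Theta> ab(3,4) show ?thesis
    proof (cases rule: actions_rel_cases)
      case 1
      then show ?thesis using sim by simp
    next
      case 2
      then show ?thesis using proj[of a b] x ab in_B by (auto simp: proj_step_neq)
    next
      case 4
      then show ?thesis using proj[of a b] x ab in_B rel_actions(2)[OF \<Theta> 4(1)]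
        by (auto simp: proj_step_neq)
    qed (auto simp: wdp_rel_def ind_rel_def)
  qed
  then show "B \<times> (M - B) \<subseteq> ser \<Theta>" by blast
  show "B \<noteq> {}" using \<open>u \<noteq> []\<close> u by (cases u) (auto simp: B_def steps_def)
qed

section \<open>Passing from words to comtraces\<close>

text \<open>All members of the class share one projection representation, so \<open>the_elem\<close>
  is applied to a singleton.\<close>

lemma comtrace_proj_comtrace_of:
  assumes \<Theta>: "comtrace_alphabet \<Theta>" and "w \<in> step_seqs \<Theta>"
  shows "comtrace_proj \<Theta> (comtrace_of \<Theta> w) = seq_proj \<Theta> w"
proof -
  have "w \<in> comtrace_of \<Theta> w"
    using comtrace_eq_refl[OF assms(2)] by (simp add: comtrace_of_def)
  moreover have "seq_proj \<Theta> v = seq_proj \<Theta> w" if "v \<in> comtrace_of \<Theta> w" for v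
    using comtrace_eq_proj[OF \<Theta>, of w v] that by (simp add: comtrace_of_def)
  ultimately have "seq_proj \<Theta> ` comtrace_of \<Theta> w = {seq_proj \<Theta> w}" by blast
  then show ?thesis by (simp add: comtrace_proj_def)
qed

lemma comtraces_iff: "\<tau> \<in> comtraces \<Theta> \<longleftrightarrow> (\<exists>w\<in>step_seqs \<Theta>. \<tau> = comtrace_of \<Theta> w)"
  by (auto simp: comtraces_def comtrace_of_def quotient_def)

lemma comtrace_of_eq_iff:
  assumes "w \<in> step_seqs \<Theta>" "v \<in> step_seqs \<Theta>"
  shows "comtrace_of \<Theta> w = comtrace_of \<Theta> v \<longleftrightarrow> (w, v) \<in> comtrace_eq \<Theta>"
  unfolding comtrace_of_def using eq_equiv_class_iff[OF equiv_comtrace_eq assms] .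

text \<open>By congruence every choice of representatives contributes the same class, and the union
  collapses to it.\<close>

lemma comtrace_conc_comtrace_of:
  assumes "w \<in> step_seqs \<Theta>" "v \<in> step_seqs \<Theta>"
  shows "comtrace_conc \<Theta> (comtrace_of \<Theta> w) (comtrace_of \<Theta> v) = comtrace_of \<Theta> (w @ v)"
proof -
  have "comtrace_of \<Theta> (w' @ v') = comtrace_of \<Theta> (w @ v)"
    if "w' \<in> comtrace_of \<Theta> w" "v' \<in> comtrace_of \<Theta> v" for w' v'
  proof -
    have *: "(w, w') \<in> comtrace_eq \<Theta>" "(v, v') \<in> comtrace_eq \<Theta>"
      using that by (auto simp: comtrace_of_def)
    from comtrace_eq_append[OF this] show ?thesis
      using comtrace_of_eq_iff[of "w @ v" \<Theta> "w' @ v'"] comtrace_eqD[OF *(1)] comtrace_eqD[OF *(2)]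
      by simp
  qed
  moreover have "w \<in> comtrace_of \<Theta> w" "v \<in> comtrace_of \<Theta> v"
    using assms by (auto simp: comtrace_of_def intro: comtrace_eq_refl)
  ultimately show ?thesis unfolding comtrace_conc_def by blast
qed

lemma allowed_set_front_set:
  assumes \<Theta>: "comtrace_alphabet \<Theta>" and "B \<in> allowed_sets \<Theta> P"
  shows "front_set \<Theta> P B" "B \<noteq> {}"
proof -
  let ?M = "possible_actions \<Theta> P"
  obtain u w v where u: "B = \<Union> (set u)" "w \<in> comtrace_of \<Theta> [?M]" "u \<noteq> []"
    "trace_eq (step_indep \<Theta>) (u @ v) w"
    using assms(2) unfolding allowed_sets_def least_equiv_seq_def trace_prefix_def by blast
  \<comment> \<open>The existence of such a \<open>w\<close> also shows that \<open>?M\<close> is a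
    step; otherwise the class of \<open>[?M]\<close> would be empty.\<close>
  have w: "([?M], w) \<in> comtrace_eq \<Theta>" using u(2) by (simp add: comtrace_of_def)
  have "(u @ v, [?M]) \<in> comtrace_eq \<Theta>"
    using trace_eq_comtrace_eq[OF \<Theta> u(4) comtrace_eqD(2)[OF w]] comtrace_eq_sym[OF w]
    by (rule comtrace_eq_trans)
  note prefix = comtrace_eq_single_prefix[OF \<Theta> this u(3), folded u(1)]
  show "front_set \<Theta> P B"
    using front_set_subset[OF possible_actions_front_set[OF \<Theta>] prefix(1,2)] .
  show "B \<noteq> {}" by (rule prefix(3))
qed

theorem theorem4p7:
  fixes \<Theta> :: "'a::linorder alphabet" and \<tau> :: "'a set list set" and B :: "'a set"
  assumes "comtrace_alphabet \<Theta>"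
    and "\<tau> \<in> comtraces \<Theta>"
    and "B \<in> allowed_sets \<Theta> (comtrace_proj \<Theta> \<tau>)"
  shows "B \<in> steps \<Theta> \<and>
    (\<exists>!\<sigma>. \<sigma> \<in> comtraces \<Theta> \<and> comtrace_proj \<Theta> \<sigma> = extr \<Theta> (comtrace_proj \<Theta> \<tau>) B) \<and>
    (\<forall>\<sigma>. \<sigma> \<in> comtraces \<Theta> \<and> comtrace_proj \<Theta> \<sigma> = extr \<Theta> (comtrace_proj \<Theta> \<tau>) B \<longrightarrow>
         \<tau> = comtrace_conc \<Theta> (comtrace_of \<Theta> [B]) \<sigma>)"
proof -
  note \<Theta> = assms(1)
  obtain w where w: "w \<in> step_seqs \<Theta>" "\<tau> = comtrace_of \<Theta> w"
    using assms(2) by (auto simp: comtraces_iff)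
  have P: "comtrace_proj \<Theta> \<tau> = seq_proj \<Theta> w"
    using comtrace_proj_comtrace_of[OF \<Theta> w(1)] w(2) by simp
  note B = allowed_set_front_set[OF \<Theta> assms(3)[unfolded P]]
  obtain v where v: "(w, B # v) \<in> comtrace_eq \<Theta>"
    using front_set_comtrace_eq[OF \<Theta> w(1) B(1)] B(2) by (auto simp: step_word_def)
  have Bv: "B \<in> steps \<Theta>" "v \<in> step_seqs \<Theta>" using comtrace_eqD(2)[OF v] by auto
  have extr: "extr \<Theta> (comtrace_proj \<Theta> \<tau>) B = seq_proj \<Theta> v"
    using extr_seq_proj_Cons[OF \<Theta> Bv(1)] comtrace_eq_proj[OF \<Theta> v] P by simp
  \<comment> \<open>One equivalence settles existence, uniqueness and the identification of the
    extracted comtrace.\<close>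
  have unique: "\<sigma> \<in> comtraces \<Theta> \<and> comtrace_proj \<Theta> \<sigma> = extr \<Theta> (comtrace_proj \<Theta> \<tau>) B \<longleftrightarrow>
      \<sigma> = comtrace_of \<Theta> v" for \<sigma>
    using Bv(2) comtrace_eq_iff_seq_proj_eq[OF \<Theta> _ Bv(2)] comtrace_of_eq_iff[OF _ Bv(2)]
    unfolding extr comtraces_iff by (metis comtrace_proj_comtrace_of[OF \<Theta>])
  have "\<tau> = comtrace_conc \<Theta> (comtrace_of \<Theta> [B]) (comtrace_of \<Theta> v)"
    using comtrace_conc_comtrace_of[of "[B]" \<Theta> v] comtrace_of_eq_iff[of w \<Theta> "B # v"] v w Bv by simp
  then show ?thesis using Bv(1) unfolding unique by simp
qed

end
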